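(* Let $\Delta x,\Delta y,\Delta z>0$, let $L\ge1$, and let $\omega_1,\dots,\omega_L$ be positive numbers with $\sum_{i=1}^L\omega_i=1$. If $\tilde{\mathbf U}^i,\hat{\mathbf U}^i,\bar{\mathbf U}^i,\breve{\mathbf U}^i,\bar{\bar{\mathbf U}}^i,\breve{\breve{\mathbf U}}^i\in\mathcal G$, $i=1,\dots,L$, satisfy the 3D "discrete divergence-free" condition $$\frac{\sum_{i=1}^L\omega_i(\tilde B_1^i-\hat B_1^i)}{\Delta x}+\frac{\sum_{i=1}^L\omega_i(\bar B_2^i-\breve B_2^i)}{\Delta y}+\frac{\sum_{i=1}^L\omega_i\big(\bar{\bar B}_3^i-\breve{\breve B}_3^i\big)}{\Delta z}=0,$$ then for any $\alpha\ge c=1$, $$\frac{1}{2\left(\frac1{\Delta x}+\frac1{\Delta y}+\frac1{\Delta z}\right)}\sum_{i=1}^L\omega_i\bigg[\frac1{\Delta x}\Big(\tilde{\mathbf U}^i-\alpha^{-1}\mathbf F_1(\tilde{\mathbf U}^i)+\hat{\mathbf U}^i+\alpha^{-1}\mathbf F_1(\hat{\mathbf U}^i)\Big)+\frac1{\Delta y}\Big(\bar{\mathbf U}^i-\alpha^{-1}\mathbf F_2(\bar{\mathbf U}^i)+\breve{\mathbf U}^i+\alpha^{-1}\mathbf F_2(\breve{\mathbf U}^i)\Big)$$ $$+\frac1{\Delta z}\Big(\bar{\bar{\mathbf U}}^i-\alpha^{-1}\mathbf F_3\big(\bar{\bar{\mathbf U}}^i\big)+\breve{\breve{\mathbf U}}^i+\alpha^{-1}\mathbf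 F_3\big(\breve{\breve{\mathbf U}}^i\big)\Big)\bigg]\in\mathcal G.$$
   Context: Fix the adiabatic index $\Gamma\in(1,2]$ (equation of state $p=(\Gamma-1)\rho e$; speed of light $c=1$). For primitive variables $\mathbf V=(\rho,\mathbf v,\mathbf B,p)$ with $\rho,p>0$, $\mathbf v,\mathbf B\in\mathbb R^3$, $|\mathbf v|<1$, put $W=(1-|\mathbf v|^2)^{-1/2}$, $e=\frac{p}{(\Gamma-1)\rho}$, $h=1+e+\frac p\rho$, $p_m=\frac12\big(W^{-2}|\mathbf B|^2+(\mathbf v\cdot\mathbf B)^2\big)$, $p_{tot}=p+p_m$. The associated conservative vector is $\mathbf U(\mathbf V)=(D,\mathbf m,\mathbf B,E)^\top\in\mathbb R^8$ with $D=\rho W$, $\mathbf m=\rho hW^2\mathbf v+|\mathbf B|^2\mathbf v-(\mathbf v\cdot\mathbf B)\mathbf B$, $E=\rho hW^2-p_{tot}+|\mathbf B|^2$. The admissible state set is $\mathcal G=\{\mathbf U(\mathbf V): \rho>0,\ p>0,\ |\mathbf v|<1,\ \mathbf B\in\mathbb R^3\}$. Each $\mathbf U\in\mathcal G$ determines its primitive variables, and for $\mathbf U\in\mathcal G$ and $k\in\{1,2,3\}$ the flux is $$\mathbf F_k(\mathbf U)=\Big(Dv_k,\ v_k\mathbf m-B_k\big(W^{-2}\mathbf B+(\mathbf v\cdot\mathbf B)\mathbf v\big)+p_{tot}\mathbf e_k,\ v_k\mathbf B-B_k\mathbf v,\ m_k\Big)^\top,$$ with $\mathbf e_k$ the $k$-th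 row of the $3\times3$ identity matrix. $\tilde B_k^i$ denotes the $k$-th component of the magnetic field of $\tilde{\mathbf U}^i$, and similarly for the other accents. *)

theory Defs
  imports "HOL-Analysis.Analysis"
begin

(* Relativistic magnetohydrodynamics in units with speed of light c = 1, ideal equation of
   state p = (G - 1) * rho * e with adiabatic index G.  Primitive variables are tuples
   (rho, v, B, p); conservative variables (D, m, B, E) live in R x R^3 x R^3 x R, which plays
   the role of R^8 with its componentwise vector space structure. *)

type_synonym prim = "real \<times> (real ^ 3) \<times> (real ^ 3) \<times> real"
type_synonym cons = "real \<times> (real ^ 3) \<times> (real ^ 3) \<times> real"

definition physical_prims :: "prim set" where
  "physical_prims = {(\<rho>, v, B, p). \<rho> > 0 \<and> p > 0 \<and> norm v < 1}"

definition lorentz_factor :: "real ^ 3 \<Rightarrow> real" where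
  "lorentz_factor v = 1 / sqrt (1 - (norm v)\<^sup>2)"

definition internal_energy :: "real \<Rightarrow> real \<Rightarrow> real \<Rightarrow> real" where
  "internal_energy \<Gamma> \<rho> p = p / ((\<Gamma> - 1) * \<rho>)"

definition enthalpy :: "real \<Rightarrow> real \<Rightarrow> real \<Rightarrow> real" where
  "enthalpy \<Gamma> \<rho> p = 1 + internal_energy \<Gamma> \<rho> p + p / \<rho>"

definition magnetic_pressure :: "real ^ 3 \<Rightarrow> real ^ 3 \<Rightarrow> real" where
  "magnetic_pressure v B = ((norm B)\<^sup>2 / (lorentz_factor v)\<^sup>2 + (v \<bullet> B)\<^sup>2) / 2"

definition total_pressure :: "real ^ 3 \<Rightarrow> real ^ 3 \<Rightarrow> real \<Rightarrow> real" where
  "total_pressure v B p = p + magnetic_pressure v B"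

definition cons_of_prim :: "real \<Rightarrow> prim \<Rightarrow> cons" where
  "cons_of_prim \<Gamma> V = (case V of (\<rho>, v, B, p) \<Rightarrow>
     let W = lorentz_factor v; h = enthalpy \<Gamma> \<rho> p in
       (\<rho> * W,
        (\<rho> * h * W\<^sup>2) *\<^sub>R v + (norm B)\<^sup>2 *\<^sub>R v - (v \<bullet> B) *\<^sub>R B,
        B,
        \<rho> * h * W\<^sup>2 - total_pressure v B p + (norm B)\<^sup>2))"

definition admissible_states :: "real \<Rightarrow> cons set" where
  "admissible_states \<Gamma> = cons_of_prim \<Gamma> ` physical_prims"

(* Only meaningful on admissible_states \<Gamma>.  The primitive variables of an admissible state are
   unique for 1 < \<Gamma> <= 2, so the choice made by inv_into is then immaterial; this uniqueness is
   not proved here. *)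
definition prim_of_cons :: "real \<Rightarrow> cons \<Rightarrow> prim" where
  "prim_of_cons \<Gamma> = inv_into physical_prims (cons_of_prim \<Gamma>)"

definition magnetic_field :: "cons \<Rightarrow> real ^ 3" where
  "magnetic_field U = (case U of (D, m, B, E) \<Rightarrow> B)"

definition flux :: "real \<Rightarrow> 3 \<Rightarrow> cons \<Rightarrow> cons" where
  "flux \<Gamma> k U = (case U of (D, m, B, E) \<Rightarrow> case prim_of_cons \<Gamma> U of (\<rho>, v, _, p) \<Rightarrow>
     let W = lorentz_factor v in
       (D * v $ k,
        (v $ k) *\<^sub>R m - (B $ k) *\<^sub>R ((1 / W\<^sup>2) *\<^sub>R B + (v \<bullet> B) *\<^sub>R v)
          + total_pressure v B p *\<^sub>R axis k 1,
        (v $ k) *\<^sub>R B - (B $ k) *\<^sub>R v,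
        m $ k))"

end

theory Submission
  imports Defs
begin

text \<open>
  Write \<open>\<theta> = 1/\<alpha>\<close>. Two facts carry the proof: admissibility is equivalent to positivity of
  the energies found by moving observers, and these are affine in the conservative state.

  Per unit of laboratory volume, an observer of velocity \<open>w\<close> with \<open>norm w < 1\<close> finds, beyond the rest
  mass \<open>D\<close>, the energy \<open>E - m \<bullet> w - D * sqrt (1 - (norm w)\<^sup>2)\<close>, up to a Lorentz factor. Subtract from
  the electromagnetic field a reference field, purely magnetic for this observer and with
  laboratory magnetic field \<open>C\<close>. The energy of the difference field differs from the original
  energy by a term linear in \<open>B\<close> and a constant, so the result is again affine in the state: it is
  \<open>observed_energy w C U + magnetic_pressure w C\<close>.

  (1) Recovery (\<open>admissible_state_if_observed_energy_positive\<close>). If \<open>D > 0\<close> and this quantity is positive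
  for all \<open>w\<close>, with \<open>C\<close> taken to be the magnetic field of the state itself, then the state is
  admissible. The momentum equation is solved explicitly for the velocity as a function of
  \<open>X = \<rho> h W\<^sup>2\<close>, and the mass equation then determines \<open>\<rho>\<close> and \<open>p\<close>. At the value of \<open>X\<close> for which the
  pressure vanishes, positivity for the corresponding velocity says exactly that the energy of
  that cold state is below \<open>E\<close>; for large \<open>X\<close> the energy exceeds \<open>E\<close>. The intermediate value theorem
  gives a state of energy \<open>E\<close>, and there the pressure is positive.

  (2) Flux bound (\<open>flux_perturbation_positive\<close>). For admissible \<open>U\<close> and \<open>\<bar>\<theta>\<bar> \<le> 1\<close>, the observed energy of
  \<open>U + \<theta> *\<^sub>R flux \<Gamma> k U\<close> is positive once the reference term is replaced by
  \<open>magnetic_pressure w C * (1 + \<theta> * w $ k)\<close> and the multiple \<open>\<theta> * B $ k * (w \<bullet> C)\<close> of the normal magnetic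
  field is subtracted. The expression is a fluid part plus the stress-energy tensor of the
  difference field, evaluated on the causal vectors \<open>(1, - n)\<close> and \<open>(1, w)\<close> with \<open>n = \<theta> *\<^sub>R axis k 1\<close>.
  The latter is nonnegative by the dominant energy condition, which is read off from Rainich's
  identity (\<open>rainich_identity\<close>). The fluid part is positive by two Cauchy-Schwarz type estimates;
  this is where \<open>\<Gamma> \<le> 2\<close> enters, through \<open>\<Gamma> / (\<Gamma> - 1) \<ge> 2\<close>.

  On adding (2) over all faces with signs \<open>- \<theta>\<close> and \<open>\<theta>\<close> on opposite faces, the terms
  \<open>magnetic_pressure w C * \<theta> * w $ k\<close> cancel pairwise, and the normal field terms add up to a multiple
  of the discrete divergence, which is zero. What remains is the hypothesis of (1) for the average
  (\<open>face_average_admissible\<close>).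
\<close>

section \<open>The electromagnetic field seen by a moving observer\<close>

text \<open>
  For a velocity \<open>v\<close> with Lorentz factor \<open>W\<close>, the spatial part of the covariant magnetic 4-vector is \<open>W\<close>
  times this vector, and its time component is \<open>W * (v \<bullet> B)\<close>.
\<close>
definition comoving_field :: "real ^ 3 \<Rightarrow> real ^ 3 \<Rightarrow> real ^ 3" where
  "comoving_field v B = (1 - (norm v)\<^sup>2) *\<^sub>R B + (v \<bullet> B) *\<^sub>R v"

text \<open>
  The field \<open>- v \<times> B\<close> of ideal magnetohydrodynamics, for which an observer of velocity \<open>v\<close> sees
  no electric field.
\<close>
definition electric_field :: "real ^ 3 \<Rightarrow> real ^ 3 \<Rightarrow> real ^ 3" where
  "electric_field v B = cross3 B v"

definition field_energy :: "real ^ 3 \<Rightarrow> real ^ 3 \<Rightarrow> real" where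
  "field_energy e b = (e \<bullet> e + b \<bullet> b) / 2"

text \<open>
  If \<open>T\<close> is the Maxwell stress-energy tensor of \<open>(e, b)\<close>, then \<open>field_energy e b - cross3 e b \<bullet> w\<close> and
  this vector are the time and space components of \<open>T\<close> contracted with
  \<open>(1, w)\<close>, up to a common sign.
\<close>
definition field_momentum_seen :: "real ^ 3 \<Rightarrow> real ^ 3 \<Rightarrow> real ^ 3 \<Rightarrow> real ^ 3" where
  "field_momentum_seen w e b = cross3 e b - field_energy e b *\<^sub>R w + (w \<bullet> e) *\<^sub>R e + (w \<bullet> b) *\<^sub>R b"

text \<open>
  Both sides express the Gram determinant of \<open>c\<close>, \<open>e\<close>, \<open>b\<close>, which is the square of their triple product.
\<close>
lemma gram_cross3:
  fixes c e b :: "real ^ 3"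
  shows "(cross3 e b \<bullet> c)\<^sup>2 + (c \<bullet> e)\<^sup>2 * (b \<bullet> b) + (c \<bullet> b)\<^sup>2 * (e \<bullet> e) - 2 * (c \<bullet> e) * (c \<bullet> b) * (e \<bullet> b)
    = (c \<bullet> c) * (cross3 e b \<bullet> cross3 e b)"
  unfolding inner_vec_def sum_3 inner_real_def cross3_def vector_3 by algebra

lemma abs_inner_le_norm:
  fixes n x :: "'a :: real_inner"
  assumes "norm n \<le> 1"
  shows "\<bar>n \<bullet> x\<bar> \<le> norm x"
  using Cauchy_Schwarz_ineq2[of n x] mult_left_le_one_le[OF norm_ge_zero norm_ge_zero assms, of x]
  by linarith

lemma poynting_le_field_energy: "norm (cross3 e b) \<le> field_energy e b"
proof -
  have "(norm (cross3 e b))\<^sup>2 \<le> (norm e * norm b)\<^sup>2"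
    by (simp flip: norm_cross_dot)
  then have "norm (cross3 e b) \<le> norm e * norm b"
    by (rule power2_le_imp_le) simp
  also have "\<dots> \<le> field_energy e b"
    using sum_squares_bound[of "norm e" "norm b"]
    by (simp add: field_energy_def dot_square_norm)
  finally show ?thesis .
qed

text \<open>
  The square of the electromagnetic stress-energy tensor is a multiple of the identity, so the
  4-vector obtained by contracting it with \<open>(1, w)\<close> has Lorentz norm proportional to that of
  \<open>(1, w)\<close>.
\<close>
lemma rainich_identity:
  "(field_energy e b - cross3 e b \<bullet> w)\<^sup>2 - (norm (field_momentum_seen w e b))\<^sup>2
    = (1 - (norm w)\<^sup>2) * ((field_energy e b)\<^sup>2 - (norm (cross3 e b))\<^sup>2)"
proof -
  define T where "T = field_energy e b"
  define S where "S = cross3 e b"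
  have S0: "S \<bullet> e = 0" "S \<bullet> b = 0"
    by (simp_all add: S_def dot_cross_self)
  have T2: "e \<bullet> e = 2 * T - b \<bullet> b"
    by (simp add: T_def field_energy_def field_simps)
  have gram: "(S \<bullet> w)\<^sup>2 + (w \<bullet> e)\<^sup>2 * (b \<bullet> b) + (w \<bullet> b)\<^sup>2 * (e \<bullet> e) - 2 * (w \<bullet> e) * (w \<bullet> b) * (e \<bullet> b)
    = (w \<bullet> w) * (S \<bullet> S)"
    unfolding S_def by (rule gram_cross3)
  have J: "(norm (field_momentum_seen w e b))\<^sup>2
    = S \<bullet> S + T\<^sup>2 * (w \<bullet> w) + (w \<bullet> e)\<^sup>2 * (e \<bullet> e) + (w \<bullet> b)\<^sup>2 * (b \<bullet> b) - 2 * T * (S \<bullet> w)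
      - 2 * T * (w \<bullet> e)\<^sup>2 - 2 * T * (w \<bullet> b)\<^sup>2 + 2 * (w \<bullet> e) * (w \<bullet> b) * (e \<bullet> b)"
    unfolding field_momentum_seen_def S_def[symmetric] T_def[symmetric] power2_norm_eq_inner
    using S0
    by (simp add: inner_add_left inner_add_right inner_diff_left inner_diff_right inner_commute
        power2_eq_square algebra_simps)
  show ?thesis
    unfolding J unfolding power2_norm_eq_inner S_def[symmetric] T_def[symmetric]
    using gram unfolding T2 by algebra
qed

text \<open>
  In \<open>rainich_identity\<close>, the factor \<open>1 - (norm w)\<^sup>2\<close> is nonnegative, and so is the other one by
  \<open>poynting_le_field_energy\<close>. Hence the energy component of the contracted 4-vector dominates its
  momentum component, and by Cauchy-Schwarz also the inner product of the latter with \<open>n\<close>.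
\<close>
lemma dominant_energy:
  assumes n: "norm n \<le> 1" and w: "norm w \<le> 1"
  shows "0 \<le> field_energy e b - cross3 e b \<bullet> w + n \<bullet> field_momentum_seen w e b"
proof -
  have S: "norm (cross3 e b) \<le> field_energy e b"
    by (rule poynting_le_field_energy)
  have "cross3 e b \<bullet> w \<le> norm (cross3 e b) * norm w"
    by (rule norm_cauchy_schwarz)
  also have "\<dots> \<le> norm (cross3 e b)"
    using w by (simp add: mult_left_le)
  finally have J0: "0 \<le> field_energy e b - cross3 e b \<bullet> w"
    using S by simp
  have "0 \<le> (1 - (norm w)\<^sup>2) * ((field_energy e b)\<^sup>2 - (norm (cross3 e b))\<^sup>2)"
    using w S by (intro mult_nonneg_nonneg) (simp_all add: power_le_one power_mono)
  then have "(norm (field_momentum_seen w e b))\<^sup>2 \<le> (field_energy e b - cross3 e b \<bullet> w)\<^sup>2"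
    unfolding rainich_identity[symmetric] by simp
  then have J: "norm (field_momentum_seen w e b) \<le> field_energy e b - cross3 e b \<bullet> w"
    using J0 by (rule power2_le_imp_le)
  have "\<bar>n \<bullet> field_momentum_seen w e b\<bar> \<le> norm (field_momentum_seen w e b)"
    using n by (rule abs_inner_le_norm)
  then show ?thesis using J by linarith
qed

section \<open>The magnetic terms of the state and the flux as Maxwell terms\<close>

lemma inverse_square_lorentz_factor:
  assumes "norm v < 1"
  shows "1 / (lorentz_factor v)\<^sup>2 = 1 - (norm v)\<^sup>2"
proof -
  have "(norm v)\<^sup>2 < 1" using assms by (simp add: power_less_one_iff)
  then show ?thesis by (simp add: lorentz_factor_def power_divide)
qed

lemma magnetic_pressure_eq:
  assumes "norm v < 1"
  shows "magnetic_pressure v B = ((1 - (norm v)\<^sup>2) * (norm B)\<^sup>2 + (v \<bullet> B)\<^sup>2) / 2"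
  unfolding magnetic_pressure_def inverse_square_lorentz_factor[OF assms, symmetric] by simp

lemma magnetic_pressure_electric:
  assumes "norm v < 1"
  shows "magnetic_pressure v B = (B \<bullet> B - electric_field v B \<bullet> electric_field v B) / 2"
  unfolding magnetic_pressure_eq[OF assms] electric_field_def dot_cross power2_norm_eq_inner
  by (simp add: power2_eq_square inner_commute algebra_simps)

lemma comoving_field_electric: "comoving_field v B = B - cross3 v (electric_field v B)"
  unfolding comoving_field_def electric_field_def Lagrange power2_norm_eq_inner
  by (simp add: algebra_simps inner_commute)

lemma momentum_electric: "cross3 (electric_field v B) B = (norm B)\<^sup>2 *\<^sub>R v - (v \<bullet> B) *\<^sub>R B"
  unfolding electric_field_def cross_skew[of "cross3 B v"] Lagrange power2_norm_eq_inner
  by (simp add: inner_commute)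

text \<open>
  Up to sign, the right-hand side is the Maxwell stress tensor applied to \<open>n\<close>. The identity is a
  polynomial one, so it is compared coordinate by coordinate.
\<close>
lemma stress_electric:
  assumes "norm v < 1"
  shows "(n \<bullet> v) *\<^sub>R cross3 (electric_field v B) B - (n \<bullet> B) *\<^sub>R comoving_field v B + magnetic_pressure v B *\<^sub>R n
   = field_energy (electric_field v B) B *\<^sub>R n - (n \<bullet> electric_field v B) *\<^sub>R electric_field v B - (n \<bullet> B) *\<^sub>R B"
  unfolding momentum_electric comoving_field_def magnetic_pressure_eq[OF assms] field_energy_def
    power2_norm_eq_inner electric_field_def
  unfolding inner_vec_def sum_3 inner_real_def cross3_def
    vec_eq_iff forall_3 vector_3 vector_minus_component vector_add_component
    vector_scaleR_component real_scaleR_def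
  unfolding power2_eq_square
  by (simp add: field_simps)

lemma cross_electric: "cross3 n (electric_field v B) = (n \<bullet> v) *\<^sub>R B - (n \<bullet> B) *\<^sub>R v"
  by (simp add: electric_field_def Lagrange)

text \<open>
  The field of the state is compared with a reference field that is purely magnetic for the
  observer \<open>w\<close>. The next two identities show that the terms in \<open>C\<close> added to the energy and to the flux
  complete the square: the result is the Maxwell expression of the difference field \<open>(e, b)\<close>.
\<close>
context
  fixes v w B C e b
  assumes v: "norm v < 1" and w: "norm w < 1"
    and e: "e = electric_field v B - electric_field w C" and b: "b = B - C"
begin

lemma em_energy_difference:
  "(norm B)\<^sup>2 - magnetic_pressure v B - ((norm B)\<^sup>2 *\<^sub>R v - (v \<bullet> B) *\<^sub>R B) \<bullet> w
     - B \<bullet> comoving_field w C + magnetic_pressure w C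
   = field_energy e b - cross3 e b \<bullet> w"
proof -
  define e0 where "e0 = electric_field v B"
  define e1 where "e1 = electric_field w C"
  have t: "w \<bullet> cross3 x C = x \<bullet> e1" for x
    unfolding e1_def electric_field_def by (metis cross_triple inner_commute)
  have u: "B \<bullet> cross3 w e1 = w \<bullet> cross3 e1 B"
    by (metis cross_triple inner_commute)
  show ?thesis
    unfolding momentum_electric[symmetric]
    unfolding comoving_field_electric magnetic_pressure_electric[OF v]
      magnetic_pressure_electric[OF w] e b field_energy_def power2_norm_eq_inner
      e0_def[symmetric] e1_def[symmetric]
    by (simp add: Cross3.left_diff_distrib Cross3.right_diff_distrib inner_diff_left inner_diff_right inner_add_right t u
        inner_commute field_simps)
qed

text \<open>
  The mixed terms in \<open>B\<close> and \<open>C\<close> match only because the multiple \<open>(n \<bullet> B) * (w \<bullet> C)\<close> of the normal field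
  is subtracted; this is the term that the discrete divergence condition has to cancel later.
\<close>
lemma em_flux_difference:
  "n \<bullet> ((norm B)\<^sup>2 *\<^sub>R v - (v \<bullet> B) *\<^sub>R B)
     - ((n \<bullet> v) *\<^sub>R ((norm B)\<^sup>2 *\<^sub>R v - (v \<bullet> B) *\<^sub>R B) - (n \<bullet> B) *\<^sub>R comoving_field v B
         + magnetic_pressure v B *\<^sub>R n) \<bullet> w
     - ((n \<bullet> v) *\<^sub>R B - (n \<bullet> B) *\<^sub>R v) \<bullet> comoving_field w C
     + magnetic_pressure w C * (n \<bullet> w) - (n \<bullet> B) * (w \<bullet> C)
   = n \<bullet> field_momentum_seen w e b"
proof -
  define e0 where "e0 = electric_field v B"
  define e1 where "e1 = electric_field w C"
  have orth: "w \<bullet> e1 = 0" "e1 \<bullet> w = 0"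
    by (simp_all add: e1_def electric_field_def dot_cross_self)
  have t: "C \<bullet> cross3 n e0 = n \<bullet> cross3 e0 C"
    by (metis cross_triple inner_commute)
  have q: "cross3 n e0 \<bullet> cross3 w e1 = (n \<bullet> w) * (e0 \<bullet> e1) - (n \<bullet> e1) * (w \<bullet> e0)"
    by (simp add: dot_cross inner_commute)
  have r: "cross3 e1 x = (C \<bullet> x) *\<^sub>R w - (w \<bullet> x) *\<^sub>R C" for x
    unfolding e1_def electric_field_def cross_skew[of "cross3 C w"] Lagrange
    by (simp add: inner_commute)
  show ?thesis
    unfolding momentum_electric[symmetric]
    unfolding stress_electric[OF v]
    unfolding cross_electric[symmetric]
      comoving_field_electric[of w] magnetic_pressure_electric[OF w] e b field_energy_def
      field_momentum_seen_def e0_def[symmetric] e1_def[symmetric]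
    by (simp add: Cross3.left_diff_distrib Cross3.right_diff_distrib inner_diff_left inner_diff_right
        inner_add_left inner_add_right t q r orth inner_commute field_simps)
qed

end

section \<open>Positivity of the fluid part\<close>

text \<open>
  The reversed Cauchy-Schwarz inequality for the timelike vectors \<open>(1, v)\<close> and \<open>(1, w)\<close>.
\<close>
lemma lorentz_product_le:
  fixes v w :: "real ^ 3"
  assumes v: "norm v < 1" and w: "norm w < 1"
  shows "sqrt (1 - (norm v)\<^sup>2) * sqrt (1 - (norm w)\<^sup>2) \<le> 1 - v \<bullet> w"
proof -
  define a b where "a = norm v" and "b = norm w"
  have ab: "0 \<le> a" "0 \<le> b" "a < 1" "b < 1"
    using v w by (simp_all add: a_def b_def)
  have le: "1 - a * b \<le> 1 - v \<bullet> w"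
    using norm_cauchy_schwarz[of v w] by (simp add: a_def b_def)
  have "0 \<le> 1 - a * b"
    using ab by (simp add: mult_le_one)
  moreover have "(1 - a\<^sup>2) * (1 - b\<^sup>2) \<le> (1 - a * b)\<^sup>2"
    using zero_le_power2[of "a - b"] by (simp add: power2_eq_square algebra_simps)
  ultimately have "sqrt ((1 - a\<^sup>2) * (1 - b\<^sup>2)) \<le> 1 - a * b"
    by (intro real_le_lsqrt)
  then show ?thesis
    using le by (simp add: real_sqrt_mult a_def b_def)
qed

text \<open>
  The difference of the two sides is affine in \<open>w\<close>, of the form \<open>R - w \<bullet> y\<close>. It is thus enough that
  \<open>norm y \<le> R\<close> and \<open>0 < R\<close>, and \<open>R\<^sup>2 - (norm y)\<^sup>2\<close> is a product of nonnegative factors.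
\<close>
lemma fluid_pressure_positive:
  fixes n v w :: "real ^ 3"
  assumes n: "norm n \<le> 1" and v: "norm v < 1" and w: "norm w < 1"
  shows "(1 - (norm v)\<^sup>2) * (1 + n \<bullet> w) < 2 * (1 + n \<bullet> v) * (1 - v \<bullet> w)"
proof -
  define a where "a = 1 + n \<bullet> v"
  define s where "s = (norm v)\<^sup>2"
  define y where "y = (2 * a) *\<^sub>R v + (1 - s) *\<^sub>R n"
  define R where "R = 2 * a - (1 - s)"
  have "\<bar>n \<bullet> v\<bar> \<le> norm v"
    using n by (rule abs_inner_le_norm)
  then have "1 - norm v \<le> a" by (simp add: a_def)
  moreover have "0 < (1 - norm v)\<^sup>2" using v by simp
  ultimately have R: "0 < R" by (simp add: R_def s_def power2_eq_square algebra_simps)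
  have "R\<^sup>2 - (norm y)\<^sup>2 = (1 - s)\<^sup>2 * (1 - (norm n)\<^sup>2)"
  proof -
    have vv: "v \<bullet> v = s" by (simp add: s_def power2_norm_eq_inner)
    have nv: "n \<bullet> v = a - 1" "v \<bullet> n = a - 1" by (simp_all add: a_def inner_commute)
    show ?thesis
      unfolding power2_norm_eq_inner y_def R_def
      by (simp add: inner_add_left inner_add_right vv nv power2_eq_square algebra_simps)
  qed
  moreover have "0 \<le> (1 - s)\<^sup>2 * (1 - (norm n)\<^sup>2)"
    using n by (simp add: power_le_one)
  ultimately have "(norm y)\<^sup>2 \<le> R\<^sup>2" by linarith
  then have "norm y \<le> R" by (rule power2_le_imp_le) (use R in simp)
  have "w \<bullet> y \<le> norm w * norm y" by (rule norm_cauchy_schwarz)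
  also have "\<dots> \<le> norm w * R" using \<open>norm y \<le> R\<close> by (simp add: mult_left_mono)
  also have "\<dots> < 1 * R" using w R by (rule mult_strict_right_mono)
  finally have "w \<bullet> y < R" by simp
  then show ?thesis
    unfolding y_def R_def s_def[symmetric] a_def[symmetric] inner_add_right inner_scaleR_right
    by (simp add: algebra_simps inner_commute)
qed

text \<open>
  The expression is linear in \<open>\<rho>\<close> and \<open>p\<close>. The coefficient of \<open>\<rho>\<close> is controlled by
  \<open>lorentz_product_le\<close>, the coefficient of \<open>p\<close> by \<open>fluid_pressure_positive\<close>; the latter has the constant
  2, whence the bound on \<open>\<kappa>\<close>.
\<close>
lemma fluid_positive:
  fixes n v w :: "real ^ 3"
  assumes n: "norm n \<le> 1" and v: "norm v < 1" and w: "norm w < 1"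
    and \<rho>: "\<rho> > 0" and p: "p > 0" and \<kappa>: "\<kappa> \<ge> 2"
  defines "r \<equiv> sqrt (1 - (norm v)\<^sup>2)"
  shows "0 < (1 + n \<bullet> v) * ((\<rho> + \<kappa> * p) / r\<^sup>2 * (1 - v \<bullet> w) - \<rho> / r * sqrt (1 - (norm w)\<^sup>2))
             - p * (1 + n \<bullet> w)"
proof -
  define q where "q = sqrt (1 - (norm w)\<^sup>2)"
  have s1: "(norm v)\<^sup>2 < 1" using v by (simp add: power_less_one_iff)
  then have r: "r > 0" "r\<^sup>2 = 1 - (norm v)\<^sup>2" by (simp_all add: r_def)
  have "\<bar>n \<bullet> v\<bar> \<le> norm v"
    using n by (rule abs_inner_le_norm)
  then have a: "0 < 1 + n \<bullet> v" using v by linarith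
  have c: "r * q \<le> 1 - v \<bullet> w"
    unfolding r_def q_def using v w by (rule lorentz_product_le)
  have "0 \<le> q" using w by (simp add: q_def power_le_one)
  then have c0: "0 \<le> 1 - v \<bullet> w" using c r(1) by (meson mult_nonneg_nonneg order.trans less_imp_le)
  have "r\<^sup>2 * (1 + n \<bullet> w) < 2 * ((1 + n \<bullet> v) * (1 - v \<bullet> w))"
    using fluid_pressure_positive[OF n v w] unfolding r(2) mult.assoc .
  also have "\<dots> \<le> \<kappa> * ((1 + n \<bullet> v) * (1 - v \<bullet> w))"
    using \<kappa> a c0 by (intro mult_right_mono) auto
  finally have P: "0 < p / r\<^sup>2 * (\<kappa> * ((1 + n \<bullet> v) * (1 - v \<bullet> w)) - r\<^sup>2 * (1 + n \<bullet> w))"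
    using p r(1) by (intro mult_pos_pos divide_pos_pos zero_less_power) linarith+
  have "0 \<le> (1 + n \<bullet> v) * (\<rho> / r\<^sup>2 * ((1 - v \<bullet> w) - r * q))"
    using a c \<rho> r(1) by (intro mult_nonneg_nonneg divide_nonneg_nonneg zero_le_power2) linarith+
  moreover have "(1 + n \<bullet> v) * ((\<rho> + \<kappa> * p) / r\<^sup>2 * (1 - v \<bullet> w) - \<rho> / r * q) - p * (1 + n \<bullet> w)
    = (1 + n \<bullet> v) * (\<rho> / r\<^sup>2 * ((1 - v \<bullet> w) - r * q))
      + p / r\<^sup>2 * (\<kappa> * ((1 + n \<bullet> v) * (1 - v \<bullet> w)) - r\<^sup>2 * (1 + n \<bullet> w))"
  proof -
    define i where "i = 1 / r\<^sup>2"
    have i: "x / r\<^sup>2 = x * i" "\<rho> / r = \<rho> * r * i" "r\<^sup>2 * i = 1" for x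
      using r(1) by (simp_all add: i_def power2_eq_square)
    show ?thesis unfolding i(1,2) using i(3) by algebra
  qed
  ultimately show ?thesis
    unfolding q_def[symmetric] using P by linarith
qed

section \<open>The observed energy of a perturbed admissible state\<close>

text \<open>
  The linear part, as a function of the state, of the energy that the observer \<open>w\<close> finds beyond the
  rest mass after the reference field of \<open>C\<close> has been subtracted; the constant part is
  \<open>magnetic_pressure w C\<close>. Everything is divided by \<open>lorentz_factor w\<close>, which keeps it polynomial in
  \<open>w\<close> apart from the mass term.
\<close>
definition observed_energy :: "real ^ 3 \<Rightarrow> real ^ 3 \<Rightarrow> cons \<Rightarrow> real" where
  "observed_energy w C U = (case U of (D, m, B, E) \<Rightarrow>
     E - m \<bullet> w - D * sqrt (1 - (norm w)\<^sup>2) - B \<bullet> comoving_field w C)"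

lemma linear_observed_energy: "linear (observed_energy w C)"
proof (rule linearI)
  show "observed_energy w C (U + V) = observed_energy w C U + observed_energy w C V" for U V
    by (cases U; cases V) (simp add: observed_energy_def inner_add_left ring_distribs)
  show "observed_energy w C (c *\<^sub>R U) = c *\<^sub>R observed_energy w C U" for c U
    by (cases U) (simp add: observed_energy_def right_diff_distrib)
qed

lemma rho_enthalpy:
  assumes "1 < \<Gamma>" "\<rho> > 0"
  shows "\<rho> * enthalpy \<Gamma> \<rho> p = \<rho> + \<Gamma> / (\<Gamma> - 1) * p"
proof -
  have "\<Gamma> / (\<Gamma> - 1) = 1 / (\<Gamma> - 1) + 1"
    using assms by (simp add: field_simps)
  then show ?thesis
    using assms by (simp add: enthalpy_def internal_energy_def distrib_left distrib_right)
qed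

lemma admissible_state_primE:
  assumes "U \<in> admissible_states \<Gamma>"
  obtains \<rho> v B p where "\<rho> > 0" "p > 0" "norm v < 1"
    "prim_of_cons \<Gamma> U = (\<rho>, v, B, p)" "U = cons_of_prim \<Gamma> (\<rho>, v, B, p)"
proof -
  have "prim_of_cons \<Gamma> U \<in> physical_prims" "cons_of_prim \<Gamma> (prim_of_cons \<Gamma> U) = U"
    using assms unfolding admissible_states_def prim_of_cons_def
    by (simp_all add: inv_into_into f_inv_into_f)
  then show ?thesis
    using that by (cases "prim_of_cons \<Gamma> U") (auto simp: physical_prims_def)
qed

text \<open>
  Stated for both signs of \<open>\<theta>\<close> at once. By \<open>em_energy_difference\<close> and \<open>em_flux_difference\<close> the
  expression splits into the quantities of \<open>fluid_positive\<close> and of \<open>dominant_energy\<close>, both for the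
  direction \<open>n = \<theta> *\<^sub>R axis k 1\<close>, of norm \<open>\<bar>\<theta>\<bar>\<close>.
\<close>
lemma flux_perturbation_positive:
  assumes \<Gamma>: "1 < \<Gamma>" "\<Gamma> \<le> 2" and U: "U \<in> admissible_states \<Gamma>"
    and \<theta>: "\<bar>\<theta>\<bar> \<le> 1" and w: "norm w < 1"
  shows "0 < observed_energy w C (U + \<theta> *\<^sub>R flux \<Gamma> k U) + magnetic_pressure w C * (1 + \<theta> * w $ k)
    - \<theta> * magnetic_field U $ k * (w \<bullet> C)"
    and "0 < fst (U + \<theta> *\<^sub>R flux \<Gamma> k U)"
proof -
  obtain \<rho> v B p where V: "\<rho> > 0" "p > 0" and v: "norm v < 1"
    and prim: "prim_of_cons \<Gamma> U = (\<rho>, v, B, p)" and cons: "U = cons_of_prim \<Gamma> (\<rho>, v, B, p)"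
    by (rule admissible_state_primE[OF U])
  define n where "n = \<theta> *\<^sub>R (axis k 1 :: real ^ 3)"
  define r where "r = sqrt (1 - (norm v)\<^sup>2)"
  define \<kappa> where "\<kappa> = \<Gamma> / (\<Gamma> - 1)"
  define X where "X = (\<rho> + \<kappa> * p) / r\<^sup>2"
  define M where "M = (norm B)\<^sup>2 *\<^sub>R v - (v \<bullet> B) *\<^sub>R B"
  have n: "norm n \<le> 1" using \<theta> by (simp add: n_def)
  have nx: "n \<bullet> x = \<theta> * x $ k" for x by (simp add: n_def inner_axis')
  have ax: "axis k (1::real) \<bullet> x = x $ k" for x by (simp add: inner_axis')
  have \<kappa>: "\<kappa> \<ge> 2" using \<Gamma> by (simp add: \<kappa>_def field_simps)
  have W: "lorentz_factor v = 1 / r" by (simp add: lorentz_factor_def r_def)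
  have W2: "1 / (lorentz_factor v)\<^sup>2 = 1 - (norm v)\<^sup>2" by (rule inverse_square_lorentz_factor[OF v])
  have XX: "\<rho> * enthalpy \<Gamma> \<rho> p * (lorentz_factor v)\<^sup>2 = X"
    by (simp add: rho_enthalpy[OF \<Gamma>(1) V(1)] W X_def \<kappa>_def power_divide)
  have Ueq: "U = (\<rho> / r, X *\<^sub>R v + M, B, X - (p + magnetic_pressure v B) + (norm B)\<^sup>2)"
    unfolding cons cons_of_prim_def Let_def prod.case XX total_pressure_def M_def
    by (simp add: W)
  have Feq: "flux \<Gamma> k U = (\<rho> / r * v $ k,
     (v $ k) *\<^sub>R (X *\<^sub>R v + M) - (B $ k) *\<^sub>R comoving_field v B + (p + magnetic_pressure v B) *\<^sub>R axis k 1,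
     (v $ k) *\<^sub>R B - (B $ k) *\<^sub>R v, (X *\<^sub>R v + M) $ k)"
    unfolding flux_def prim unfolding Ueq Let_def prod.case W2 total_pressure_def comoving_field_def by simp
  define e where "e = electric_field v B - electric_field w C"
  define b where "b = B - C"
  have em1: "(norm B)\<^sup>2 - magnetic_pressure v B - M \<bullet> w - B \<bullet> comoving_field w C + magnetic_pressure w C
    = field_energy e b - cross3 e b \<bullet> w"
    unfolding M_def by (rule em_energy_difference[OF v w e_def b_def])
  have em2: "\<theta> * M $ k
     - (\<theta> * v $ k * (M \<bullet> w) - \<theta> * B $ k * (comoving_field v B \<bullet> w) + magnetic_pressure v B * (\<theta> * w $ k))
     - (\<theta> * v $ k * (B \<bullet> comoving_field w C) - \<theta> * B $ k * (v \<bullet> comoving_field w C))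
     + magnetic_pressure w C * (\<theta> * w $ k) - \<theta> * B $ k * (w \<bullet> C)
     = n \<bullet> field_momentum_seen w e b"
    using em_flux_difference[OF v w e_def b_def, of n, folded M_def]
    by (simp only: inner_add_left inner_diff_left inner_scaleR_left nx)
  have em: "0 \<le> field_energy e b - cross3 e b \<bullet> w + n \<bullet> field_momentum_seen w e b"
    using n w by (intro dominant_energy) auto
  have fluid: "0 < (1 + \<theta> * v $ k) * (X * (1 - v \<bullet> w) - \<rho> / r * sqrt (1 - (norm w)\<^sup>2)) - p * (1 + \<theta> * w $ k)"
    using fluid_positive[OF n v w V \<kappa>] by (simp add: nx r_def X_def)
  have "observed_energy w C (U + \<theta> *\<^sub>R flux \<Gamma> k U) + magnetic_pressure w C * (1 + \<theta> * w $ k)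
      - \<theta> * magnetic_field U $ k * (w \<bullet> C)
    = ((1 + \<theta> * v $ k) * (X * (1 - v \<bullet> w) - \<rho> / r * sqrt (1 - (norm w)\<^sup>2)) - p * (1 + \<theta> * w $ k))
      + (field_energy e b - cross3 e b \<bullet> w + n \<bullet> field_momentum_seen w e b)"
    unfolding em1[symmetric] em2[symmetric] unfolding Feq unfolding Ueq
    by (simp add: observed_energy_def magnetic_field_def inner_add_left inner_diff_left ax add_divide_distrib algebra_simps)
  then show "0 < observed_energy w C (U + \<theta> *\<^sub>R flux \<Gamma> k U) + magnetic_pressure w C * (1 + \<theta> * w $ k)
    - \<theta> * magnetic_field U $ k * (w \<bullet> C)"
    using em fluid by linarith
  have r: "r > 0" using v by (simp add: r_def power_less_one_iff)
  \<comment> \<open>The mass density is multiplied by \<open>1 + \<theta> * v $ k\<close>, which is positive since the flow is subluminal.\<close>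
  have "\<bar>n \<bullet> v\<bar> \<le> norm v"
    using n by (rule abs_inner_le_norm)
  then have "0 < 1 + \<theta> * v $ k" using v by (simp add: nx)
  then have "0 < \<rho> / r * (1 + \<theta> * v $ k)"
    using V r by simp
  then show "0 < fst (U + \<theta> *\<^sub>R flux \<Gamma> k U)"
    unfolding Feq unfolding Ueq by (simp add: algebra_simps)
qed

section \<open>Recovering the primitive variables\<close>

text \<open>
  The solution \<open>v\<close> of the momentum equation \<open>m = (X + (norm B)\<^sup>2) *\<^sub>R v - (v \<bullet> B) *\<^sub>R B\<close> for a given value of
  \<open>X = \<rho> h W\<^sup>2\<close>; pairing the equation with \<open>B\<close> gives \<open>v \<bullet> B = (m \<bullet> B) / X\<close>.
\<close>
definition recovered_velocity :: "real ^ 3 \<Rightarrow> real ^ 3 \<Rightarrow> real \<Rightarrow> real ^ 3" where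
  "recovered_velocity m B X = (1 / (X + B \<bullet> B)) *\<^sub>R (m + ((m \<bullet> B) / X) *\<^sub>R B)"

lemma momentum_recovered_velocity:
  assumes X: "X > 0"
  shows "X *\<^sub>R recovered_velocity m B X + (norm B)\<^sup>2 *\<^sub>R recovered_velocity m B X
           - (recovered_velocity m B X \<bullet> B) *\<^sub>R B = m"
proof -
  have pos: "0 < X + B \<bullet> B" using X by (simp add: add_pos_nonneg)
  have "recovered_velocity m B X \<bullet> B = (1 / (X + B \<bullet> B)) * ((m \<bullet> B) / X * (X + B \<bullet> B))"
    using X by (simp add: recovered_velocity_def inner_add_left distrib_left)
  then have vB: "recovered_velocity m B X \<bullet> B = (m \<bullet> B) / X"
    using pos by simp
  have "(X + B \<bullet> B) *\<^sub>R recovered_velocity m B X = m + ((m \<bullet> B) / X) *\<^sub>R B"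
    using pos by (simp add: recovered_velocity_def)
  then show ?thesis
    unfolding vB power2_norm_eq_inner by (simp add: scaleR_add_left)
qed

lemma norm_recovered_velocity:
  assumes "X > 0"
  shows "(norm (recovered_velocity m B X))\<^sup>2
    = ((norm m)\<^sup>2 + 2 * (m \<bullet> B)\<^sup>2 / X + (m \<bullet> B)\<^sup>2 * (norm B)\<^sup>2 / X\<^sup>2) / (X + (norm B)\<^sup>2)\<^sup>2"
proof -
  have "(norm (m + ((m \<bullet> B) / X) *\<^sub>R B))\<^sup>2
    = (norm m)\<^sup>2 + 2 * (m \<bullet> B)\<^sup>2 / X + (m \<bullet> B)\<^sup>2 * (norm B)\<^sup>2 / X\<^sup>2"
    unfolding power2_norm_eq_inner
    by (simp add: inner_add_left inner_add_right inner_commute power2_eq_square)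
  then show ?thesis
    unfolding recovered_velocity_def norm_scaleR power_mult_distrib
    by (simp add: power2_norm_eq_inner power_divide)
qed

text \<open>
  A larger inertia \<open>X\<close> needs a smaller velocity to carry the same momentum. Subluminality thus
  persists when \<open>X\<close> grows.
\<close>
lemma recovered_velocity_antimono:
  assumes "0 < X" "X \<le> Y"
  shows "(norm (recovered_velocity m B Y))\<^sup>2 \<le> (norm (recovered_velocity m B X))\<^sup>2"
proof -
  have Y: "0 < Y" using assms by linarith
  show ?thesis
    unfolding norm_recovered_velocity[OF assms(1)] norm_recovered_velocity[OF Y]
    using assms Y
    by (intro frac_le add_mono divide_left_mono power_mono mult_pos_pos zero_less_power
        add_nonneg_nonneg mult_nonneg_nonneg divide_nonneg_nonneg add_pos_nonneg) auto
qed

lemma continuous_recovered_velocity: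
  assumes "0 < a"
  shows "continuous_on {a..b} (recovered_velocity m B)"
proof -
  have "X + B \<bullet> B \<noteq> 0" "X \<noteq> 0" if "X \<in> {a..b}" for X
    using that assms by (smt (verit) atLeastAtMost_iff inner_ge_zero)+
  then show ?thesis
    unfolding recovered_velocity_def by (intro continuous_intros) auto
qed

text \<open>
  The value of \<open>X\<close> at which a fluid with mass density \<open>D\<close>, momentum \<open>m\<close> and field \<open>B\<close> has zero pressure, that
  is \<open>X = D * W\<close>. The squared equation is solved by the intermediate value theorem, since
  \<open>X\<^sup>2 * (1 - (norm v)\<^sup>2)\<close> is at most \<open>X\<^sup>2\<close> for small \<open>X\<close> and grows like \<open>X\<^sup>2\<close> for large \<open>X\<close>.
\<close>
lemma cold_fluid_solution:
  assumes D: "D > 0"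
  obtains X where "X > 0" "norm (recovered_velocity m B X) < 1"
    "X * sqrt (1 - (norm (recovered_velocity m B X))\<^sup>2) = D"
proof -
  define g where "g = (\<lambda>X. X\<^sup>2 * (1 - (norm (recovered_velocity m B X))\<^sup>2))"
  define K where "K = norm m + \<bar>m \<bullet> B\<bar> * norm B"
  \<comment> \<open>Large enough that the recovered velocity at \<open>Y\<close> is at most one half.\<close>
  define Y where "Y = 2 * (1 + D + K)"
  have K: "K \<ge> 0" by (simp add: K_def)
  have Y: "Y \<ge> 1" "Y \<ge> 2 * D" "Y \<ge> 2 * K" "Y > 0" using D K by (simp_all add: Y_def)
  have low: "g (D / 2) \<le> D\<^sup>2"
  proof -
    have "g (D / 2) \<le> (D / 2)\<^sup>2 * 1"
      unfolding g_def by (intro mult_left_mono) auto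
    also have "\<dots> \<le> D\<^sup>2"
      using D by (simp add: power_divide)
    finally show ?thesis .
  qed
  have "norm (recovered_velocity m B Y) \<le> 1 / 2"
  proof -
    have "norm (m + ((m \<bullet> B) / Y) *\<^sub>R B) \<le> norm m + \<bar>m \<bullet> B\<bar> / Y * norm B"
      using norm_triangle_ineq[of m "((m \<bullet> B) / Y) *\<^sub>R B"] Y by simp
    also have "\<bar>m \<bullet> B\<bar> / Y \<le> \<bar>m \<bullet> B\<bar>"
      using Y by (simp add: divide_le_eq mult_le_cancel_left1)
    finally have a: "norm (m + ((m \<bullet> B) / Y) *\<^sub>R B) \<le> K"
      by (simp add: K_def mult_right_mono)
    have "norm (recovered_velocity m B Y) = norm (m + ((m \<bullet> B) / Y) *\<^sub>R B) / (Y + B \<bullet> B)"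
      using Y by (simp add: recovered_velocity_def add_nonneg_nonneg)
    also have "\<dots> \<le> K / Y"
      using a Y K by (intro frac_le) auto
    also have "\<dots> \<le> 1 / 2"
      using Y by (simp add: divide_le_eq)
    finally show ?thesis .
  qed
  then have "(norm (recovered_velocity m B Y))\<^sup>2 \<le> (1 / 2)\<^sup>2"
    by (intro power_mono) auto
  then have "(2 * D)\<^sup>2 * (3 / 4) \<le> g Y"
    unfolding g_def using Y D by (intro mult_mono power_mono) (auto simp: power2_eq_square)
  have high: "D\<^sup>2 \<le> g Y"
  proof -
    have "3 * D\<^sup>2 \<le> g Y"
      using \<open>(2 * D)\<^sup>2 * (3 / 4) \<le> g Y\<close> by (simp add: power_mult_distrib)
    then show ?thesis using zero_le_power2[of D] by linarith
  qed
  have cont: "continuous_on {D / 2..Y} g"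
    unfolding g_def using D by (intro continuous_intros continuous_recovered_velocity) auto
  obtain X where X: "D / 2 \<le> X" "X \<le> Y" "g X = D\<^sup>2"
    using IVT'[OF low high _ cont] Y D by auto
  have X0: "X > 0" using X D by linarith
  have "0 < X\<^sup>2 * (1 - (norm (recovered_velocity m B X))\<^sup>2)"
    using X(3) D unfolding g_def by simp
  then have lt: "(norm (recovered_velocity m B X))\<^sup>2 < 1"
    using X0 by (simp add: zero_less_mult_iff)
  then have "norm (recovered_velocity m B X) < 1"
    by (simp add: power_less_one_iff)
  moreover have "X * sqrt (1 - (norm (recovered_velocity m B X))\<^sup>2) = sqrt (g X)"
    using X0 by (simp add: g_def real_sqrt_mult)
  then have "X * sqrt (1 - (norm (recovered_velocity m B X))\<^sup>2) = D"
    using X(3) D by simp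
  ultimately show ?thesis using that X0 by blast
qed

text \<open>
  Along the curve \<open>X \<mapsto> (recovered_velocity m B X, p)\<close> on which mass and momentum are right, the
  energy is compared with \<open>E\<close>. It is too low at the cold state, by the hypothesis for the velocity of
  that state, and tends to infinity with \<open>X\<close>. The pressure is positive beyond the cold state.
\<close>
lemma admissible_state_if_observed_energy_positive:
  assumes \<Gamma>: "1 < \<Gamma>" and D: "D > 0"
    and obs: "\<And>w. norm w < 1 \<Longrightarrow> 0 < observed_energy w B (D, m, B, E) + magnetic_pressure w B"
  shows "(D, m, B, E) \<in> admissible_states \<Gamma>"
proof -
  define v where "v = recovered_velocity m B"
  define r where "r = (\<lambda>X. sqrt (1 - (norm (v X))\<^sup>2))"
  define \<kappa> where "\<kappa> = \<Gamma> / (\<Gamma> - 1)"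
  \<comment> \<open>The pressure forced by the mass equation, the magnetic pressure, and the resulting energy.\<close>
  define P where "P = (\<lambda>X. (X * (1 - (norm (v X))\<^sup>2) - D * r X) / \<kappa>)"
  define Q where "Q = (\<lambda>X. ((1 - (norm (v X))\<^sup>2) * (norm B)\<^sup>2 + (v X \<bullet> B)\<^sup>2) / 2)"
  define f where "f = (\<lambda>X. X - (P X + Q X) + (norm B)\<^sup>2)"
  have \<kappa>: "\<kappa> > 0" "1 - 1 / \<kappa> = 1 / \<Gamma>" using \<Gamma> by (simp_all add: \<kappa>_def field_simps)
  obtain X0 where X0: "X0 > 0" "norm (v X0) < 1" "X0 * r X0 = D"
    using cold_fluid_solution[OF D, of m B] unfolding v_def r_def by blast
  have v1: "(norm (v X))\<^sup>2 < 1" "norm (v X) < 1" if "X0 \<le> X" for X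
  proof -
    have "(norm (v X))\<^sup>2 \<le> (norm (v X0))\<^sup>2"
      unfolding v_def using X0(1) that by (rule recovered_velocity_antimono)
    also have "\<dots> < 1" using X0(2) by (simp add: power_less_one_iff)
    finally show "(norm (v X))\<^sup>2 < 1" .
    then show "norm (v X) < 1" by (simp add: power_less_one_iff)
  qed
  have r2: "(r X)\<^sup>2 = 1 - (norm (v X))\<^sup>2" "r X > 0" if "X0 \<le> X" for X
    using v1[OF that] by (simp_all add: r_def)
  have mom: "m = X *\<^sub>R v X + (norm B)\<^sup>2 *\<^sub>R v X - (v X \<bullet> B) *\<^sub>R B" if "X0 \<le> X" for X
    using momentum_recovered_velocity[of X m B] X0(1) that unfolding v_def by auto
  have low: "f X0 < E"
  proof -
    have mass: "D * r X0 = X0 * (1 - (norm (v X0))\<^sup>2)"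
      unfolding r2(1)[OF order_refl, symmetric] X0(3)[symmetric] by (simp add: power2_eq_square)
    then have "P X0 = 0" by (simp add: P_def)
    note mass
    moreover have "m \<bullet> v X0 = X0 * (norm (v X0))\<^sup>2 + (norm B)\<^sup>2 * (norm (v X0))\<^sup>2 - (v X0 \<bullet> B)\<^sup>2"
      using arg_cong[OF mom[OF order_refl], of "\<lambda>x. x \<bullet> v X0"]
      unfolding inner_add_left inner_diff_left inner_scaleR_left power2_norm_eq_inner
      by (simp add: inner_commute power2_eq_square)
    moreover have "B \<bullet> comoving_field (v X0) B = 2 * Q X0"
      unfolding comoving_field_def Q_def inner_add_right inner_scaleR_right power2_norm_eq_inner
      by (simp add: inner_commute power2_eq_square)
    moreover have "magnetic_pressure (v X0) B = Q X0"
      unfolding Q_def by (rule magnetic_pressure_eq[OF X0(2)])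
    moreover have "0 < E - m \<bullet> v X0 - D * r X0 - B \<bullet> comoving_field (v X0) B
        + magnetic_pressure (v X0) B"
      using obs[OF X0(2)] by (simp add: observed_energy_def r_def)
    ultimately have "0 < E - (X0 * (norm (v X0))\<^sup>2 + (norm B)\<^sup>2 * (norm (v X0))\<^sup>2 - (v X0 \<bullet> B)\<^sup>2)
        - X0 * (1 - (norm (v X0))\<^sup>2) - Q X0"
      by linarith
    moreover have "2 * Q X0 = (norm B)\<^sup>2 - (norm B)\<^sup>2 * (norm (v X0))\<^sup>2 + (v X0 \<bullet> B)\<^sup>2"
      by (simp add: Q_def) (simp add: algebra_simps)
    moreover have "f X0 = X0 - Q X0 + (norm B)\<^sup>2"
      by (simp add: f_def \<open>P X0 = 0\<close>)
    ultimately show ?thesis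
      by (simp add: right_diff_distrib)
  qed
  \<comment> \<open>The gas pressure is at most \<open>X / \<kappa>\<close> and the magnetic one at most \<open>(norm B)\<^sup>2\<close>, so the energy is at least \<open>X / \<Gamma>\<close>.\<close>
  define X1 where "X1 = max X0 (\<Gamma> * \<bar>E\<bar>)"
  have X1: "X0 \<le> X1" "X1 > 0" using X0(1) by (auto simp: X1_def)
  have high: "E \<le> f X1"
  proof -
    define s where "s = (norm (v X1))\<^sup>2"
    have s: "0 \<le> s" "s < 1" using v1[OF X1(1)] by (simp_all add: s_def)
    have "X1 * (1 - s) - D * r X1 \<le> X1"
      using X1 s D r2(2)[OF X1(1)] by (smt (verit) mult_nonneg_nonneg mult_left_le)
    then have "P X1 \<le> X1 / \<kappa>"
      unfolding P_def s_def[symmetric] using \<kappa> by (simp add: divide_right_mono)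
    moreover have "(v X1 \<bullet> B)\<^sup>2 \<le> s * (norm B)\<^sup>2"
      using Cauchy_Schwarz_ineq[of "v X1" B] by (simp add: s_def power2_norm_eq_inner)
    then have "(1 - s) * (norm B)\<^sup>2 + (v X1 \<bullet> B)\<^sup>2 \<le> (norm B)\<^sup>2"
      by (simp add: left_diff_distrib)
    then have "Q X1 \<le> (norm B)\<^sup>2 / 2"
      unfolding Q_def s_def[symmetric] by (rule divide_right_mono) simp
    then have "Q X1 \<le> (norm B)\<^sup>2"
      using zero_le_power2[of "norm B"] by linarith
    moreover have "X1 - X1 / \<kappa> = X1 / \<Gamma>"
      using arg_cong[OF \<kappa>(2), of "\<lambda>t. X1 * t"] by (simp add: right_diff_distrib)
    moreover have "\<bar>E\<bar> \<le> X1 / \<Gamma>"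
      using \<Gamma> by (simp add: X1_def le_divide_eq mult.commute)
    ultimately show ?thesis unfolding f_def by linarith
  qed
  have cont: "continuous_on {X0..X1} f"
    unfolding f_def P_def Q_def r_def v_def using X0(1) \<kappa>(1)
    by (intro continuous_intros continuous_recovered_velocity) auto
  obtain X where X: "X0 \<le> X" "X \<le> X1" "f X = E"
    using IVT'[OF less_imp_le[OF low] high X1(1) cont] by auto
  have "X0 < X" using X low by (cases "X = X0") auto
  note vX = v1(2)[OF X(1)] and rX = r2[OF X(1)]
  have r_mono: "r X0 \<le> r X"
    unfolding r_def v_def using recovered_velocity_antimono[OF X0(1) X(1), of m B] by simp
  \<comment> \<open>Beyond the cold value \<open>X0\<close> the fluid has thermal energy, hence positive pressure.\<close>
  have "D < X * r X"
  proof -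
    have "D = X0 * r X0" using X0(3) by simp
    also have "\<dots> \<le> X0 * r X" using r_mono X0(1) by simp
    also have "\<dots> < X * r X" using \<open>X0 < X\<close> rX(2) by simp
    finally show ?thesis .
  qed
  have P_eq: "\<kappa> * P X = (X * r X - D) * r X"
  proof -
    have "\<kappa> * P X = X * (r X)\<^sup>2 - D * r X"
      using \<kappa>(1) unfolding P_def rX(1)[symmetric] by simp
    then show ?thesis by (simp add: power2_eq_square algebra_simps)
  qed
  then have "0 < \<kappa> * P X" using \<open>D < X * r X\<close> rX(2) by simp
  then have P: "P X > 0" using \<kappa>(1) by (simp add: zero_less_mult_iff)
  have \<rho>: "D * r X > 0" using D rX(2) by simp
  have W: "lorentz_factor (v X) = 1 / r X" by (simp add: lorentz_factor_def r_def)
  have XX: "D * r X * enthalpy \<Gamma> (D * r X) (P X) * (lorentz_factor (v X))\<^sup>2 = X"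
    unfolding rho_enthalpy[OF \<Gamma> \<rho>] \<kappa>_def[symmetric] P_eq W using rX(2)
    by (simp add: power2_eq_square field_simps)
  have "cons_of_prim \<Gamma> (D * r X, v X, B, P X) = (D, m, B, E)"
    unfolding cons_of_prim_def Let_def prod.case XX total_pressure_def mom[OF X(1), symmetric]
      magnetic_pressure_eq[OF vX]
    using rX(2) X(3) by (simp add: W f_def Q_def)
  moreover have "(D * r X, v X, B, P X) \<in> physical_prims"
    using \<rho> P vX by (simp add: physical_prims_def)
  ultimately show ?thesis
    unfolding admissible_states_def by (metis image_eqI)
qed

section \<open>Averages over faces\<close>

text \<open>
  With opposite signs of \<open>\<theta>\<close> on opposite faces, the terms \<open>\<theta> * w $ k\<close> cancel and only the jump of the
  normal magnetic field is left.
\<close>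
lemma face_pair_positive:
  assumes \<Gamma>: "1 < \<Gamma>" "\<Gamma> \<le> 2"
    and U: "U \<in> admissible_states \<Gamma>" and V: "V \<in> admissible_states \<Gamma>"
    and \<theta>: "\<bar>\<theta>\<bar> \<le> 1" and w: "norm w < 1"
  shows "0 < observed_energy w C (U - \<theta> *\<^sub>R flux \<Gamma> k U + V + \<theta> *\<^sub>R flux \<Gamma> k V)
    + 2 * magnetic_pressure w C
    + \<theta> * (w \<bullet> C) * (magnetic_field U $ k - magnetic_field V $ k)"
    and "0 < fst (U - \<theta> *\<^sub>R flux \<Gamma> k U + V + \<theta> *\<^sub>R flux \<Gamma> k V)"
proof -
  have split: "U - \<theta> *\<^sub>R flux \<Gamma> k U + V + \<theta> *\<^sub>R flux \<Gamma> k V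
    = (U + (- \<theta>) *\<^sub>R flux \<Gamma> k U) + (V + \<theta> *\<^sub>R flux \<Gamma> k V)"
    by simp
  have \<theta>': "\<bar>- \<theta>\<bar> \<le> 1" using \<theta> by simp
  show "0 < observed_energy w C (U - \<theta> *\<^sub>R flux \<Gamma> k U + V + \<theta> *\<^sub>R flux \<Gamma> k V)
    + 2 * magnetic_pressure w C
    + \<theta> * (w \<bullet> C) * (magnetic_field U $ k - magnetic_field V $ k)"
    using flux_perturbation_positive(1)[OF \<Gamma> U \<theta>' w, of C k]
      flux_perturbation_positive(1)[OF \<Gamma> V \<theta> w, of C k]
    unfolding split linear_add[OF linear_observed_energy] by (simp add: algebra_simps)
  show "0 < fst (U - \<theta> *\<^sub>R flux \<Gamma> k U + V + \<theta> *\<^sub>R flux \<Gamma> k V)"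
    using flux_perturbation_positive(2)[OF \<Gamma> U \<theta>' w, of k]
      flux_perturbation_positive(2)[OF \<Gamma> V \<theta> w, of k]
    unfolding split fst_add by linarith
qed

text \<open>
  A finite family of face pairs \<open>(U j, V j)\<close> with normal directions \<open>k j\<close> and weights \<open>c j\<close> allows all
  directions and quadrature points to be treated at once. The jump terms of \<open>face_pair_positive\<close>
  carry the common factor \<open>\<theta> * (w \<bullet> C)\<close>, so they vanish in the sum by \<open>balance\<close>.
\<close>
lemma face_average_admissible:
  assumes \<Gamma>: "1 < \<Gamma>" "\<Gamma> \<le> 2"
    and J: "finite J" "J \<noteq> {}" and pos: "\<And>j. j \<in> J \<Longrightarrow> c j > 0"
    and U: "\<And>j. j \<in> J \<Longrightarrow> U j \<in> admissible_states \<Gamma>"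
    and V: "\<And>j. j \<in> J \<Longrightarrow> V j \<in> admissible_states \<Gamma>"
    and balance: "(\<Sum>j\<in>J. c j * (magnetic_field (U j) $ k j - magnetic_field (V j) $ k j)) = 0"
    and \<theta>: "\<bar>\<theta>\<bar> \<le> 1"
  shows "(1 / (2 * sum c J)) *\<^sub>R
    (\<Sum>j\<in>J. c j *\<^sub>R (U j - \<theta> *\<^sub>R flux \<Gamma> (k j) (U j) + V j + \<theta> *\<^sub>R flux \<Gamma> (k j) (V j)))
    \<in> admissible_states \<Gamma>"
proof -
  define P where "P = (\<lambda>j. U j - \<theta> *\<^sub>R flux \<Gamma> (k j) (U j) + V j + \<theta> *\<^sub>R flux \<Gamma> (k j) (V j))"
  define \<Lambda> where "\<Lambda> = sum c J"
  define R where "R = (1 / (2 * \<Lambda>)) *\<^sub>R (\<Sum>j\<in>J. c j *\<^sub>R P j)"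
  obtain D m B E where R: "R = (D, m, B, E)" by (cases R)
  have \<Lambda>: "\<Lambda> > 0" unfolding \<Lambda>_def using J pos by (intro sum_pos)
  have "0 < (\<Sum>j\<in>J. c j * fst (P j))"
    using J pos face_pair_positive(2)[OF \<Gamma> U V \<theta>, of _ _ 0] unfolding P_def
    by (intro sum_pos mult_pos_pos) auto
  then have "0 < fst R"
    unfolding R_def using \<Lambda> by (simp add: fst_sum)
  then have D: "D > 0" by (simp add: R)
  \<comment> \<open>The reference field is the one of the average itself, as the recovery lemma requires.\<close>
  have obs: "0 < observed_energy w B (D, m, B, E) + magnetic_pressure w B" if w: "norm w < 1" for w
  proof -
    define \<mu> where "\<mu> = magnetic_pressure w B"
    define \<delta> where "\<delta> = (\<lambda>j. magnetic_field (U j) $ k j - magnetic_field (V j) $ k j)"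
    have "0 < (\<Sum>j\<in>J. c j * (observed_energy w B (P j) + 2 * \<mu> + \<theta> * (w \<bullet> B) * \<delta> j))"
      using J pos face_pair_positive(1)[OF \<Gamma> U V \<theta> w] unfolding P_def \<delta>_def \<mu>_def
      by (intro sum_pos mult_pos_pos) auto
    also have "\<dots> = (\<Sum>j\<in>J. c j * observed_energy w B (P j)) + 2 * \<mu> * \<Lambda>
        + \<theta> * (w \<bullet> B) * (\<Sum>j\<in>J. c j * \<delta> j)"
      unfolding \<Lambda>_def sum_distrib_left sum.distrib[symmetric]
      by (intro sum.cong) (simp_all add: algebra_simps)
    also have "\<dots> = 2 * \<Lambda> * (observed_energy w B R + \<mu>)"
      unfolding R_def linear_scale[OF linear_observed_energy] linear_sum[OF linear_observed_energy]
      using balance \<Lambda> by (simp add: \<delta>_def algebra_simps)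
    finally show ?thesis
      using \<Lambda> by (simp add: zero_less_mult_iff R \<mu>_def)
  qed
  have "R \<in> admissible_states \<Gamma>"
    unfolding R using \<Gamma>(1) D obs by (rule admissible_state_if_observed_energy_positive)
  then show ?thesis by (simp add: R_def P_def \<Lambda>_def)
qed

theorem theorem2p6:
  fixes \<Gamma> \<Delta>x \<Delta>y \<Delta>z \<alpha> :: real
    and L :: nat
    and \<omega> :: "nat \<Rightarrow> real"
    and U_tilde U_hat U_bar U_breve U_bar2 U_breve2 :: "nat \<Rightarrow> cons"
  assumes "1 < \<Gamma>" and "\<Gamma> \<le> 2"
    and "\<Delta>x > 0" and "\<Delta>y > 0" and "\<Delta>z > 0"
    and "L \<ge> 1"
    and "\<And>i. i \<in> {1..L} \<Longrightarrow> \<omega> i > 0"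
    and "(\<Sum>i=1..L. \<omega> i) = 1"
    and "\<And>i. i \<in> {1..L} \<Longrightarrow> U_tilde i \<in> admissible_states \<Gamma>"
    and "\<And>i. i \<in> {1..L} \<Longrightarrow> U_hat i \<in> admissible_states \<Gamma>"
    and "\<And>i. i \<in> {1..L} \<Longrightarrow> U_bar i \<in> admissible_states \<Gamma>"
    and "\<And>i. i \<in> {1..L} \<Longrightarrow> U_breve i \<in> admissible_states \<Gamma>"
    and "\<And>i. i \<in> {1..L} \<Longrightarrow> U_bar2 i \<in> admissible_states \<Gamma>"
    and "\<And>i. i \<in> {1..L} \<Longrightarrow> U_breve2 i \<in> admissible_states \<Gamma>"
    and "(\<Sum>i=1..L. \<omega> i * (magnetic_field (U_tilde i) $ 1 - magnetic_field (U_hat i) $ 1)) / \<Delta>x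
       + (\<Sum>i=1..L. \<omega> i * (magnetic_field (U_bar i) $ 2 - magnetic_field (U_breve i) $ 2)) / \<Delta>y
       + (\<Sum>i=1..L. \<omega> i * (magnetic_field (U_bar2 i) $ 3 - magnetic_field (U_breve2 i) $ 3)) / \<Delta>z
       = 0"
    and "\<alpha> \<ge> 1"
  shows "(1 / (2 * (1 / \<Delta>x + 1 / \<Delta>y + 1 / \<Delta>z))) *\<^sub>R
     (\<Sum>i=1..L. \<omega> i *\<^sub>R
        ((1 / \<Delta>x) *\<^sub>R (U_tilde i - inverse \<alpha> *\<^sub>R flux \<Gamma> 1 (U_tilde i)
                       + U_hat i + inverse \<alpha> *\<^sub>R flux \<Gamma> 1 (U_hat i))
       + (1 / \<Delta>y) *\<^sub>R (U_bar i - inverse \<alpha> *\<^sub>R flux \<Gamma> 2 (U_bar i)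
                       + U_breve i + inverse \<alpha> *\<^sub>R flux \<Gamma> 2 (U_breve i))
       + (1 / \<Delta>z) *\<^sub>R (U_bar2 i - inverse \<alpha> *\<^sub>R flux \<Gamma> 3 (U_bar2 i)
                       + U_breve2 i + inverse \<alpha> *\<^sub>R flux \<Gamma> 3 (U_breve2 i))))
     \<in> admissible_states \<Gamma>"
proof -
  define \<theta> where "\<theta> = inverse \<alpha>"
  \<comment> \<open>A face pair is indexed by its quadrature point and its normal direction.\<close>
  define J where "J = {1..L} \<times> (UNIV :: 3 set)"
  define h where "h = (\<lambda>k :: 3. if k = 1 then 1 / \<Delta>x else if k = 2 then 1 / \<Delta>y else 1 / \<Delta>z)"
  define c where "c = (\<lambda>(i, k). \<omega> i * h k)"
  define U where "U = (\<lambda>(i, k :: 3). if k = 1 then U_tilde i else if k = 2 then U_bar i else U_bar2 i)"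
  define V where "V = (\<lambda>(i, k :: 3). if k = 1 then U_hat i else if k = 2 then U_breve i else U_breve2 i)"
  have face_sum: "sum f J = (\<Sum>i=1..L. f (i, 1) + f (i, 2) + f (i, 3))" for f :: "nat \<times> 3 \<Rightarrow> 'b::comm_monoid_add"
    unfolding J_def by (simp add: sum.cartesian_product' sum_3)
  have total: "sum c J = 1 / \<Delta>x + 1 / \<Delta>y + 1 / \<Delta>z"
  proof -
    have "sum c J = (\<Sum>i=1..L. \<omega> i) * (1 / \<Delta>x + 1 / \<Delta>y + 1 / \<Delta>z)"
      unfolding face_sum sum_distrib_right by (simp add: c_def h_def distrib_left)
    then show ?thesis using assms(8) by simp
  qed
  have balance: "(\<Sum>j\<in>J. c j * (magnetic_field (U j) $ snd j - magnetic_field (V j) $ snd j)) = 0"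
  proof -
    have "(\<Sum>j\<in>J. c j * (magnetic_field (U j) $ snd j - magnetic_field (V j) $ snd j))
      = (\<Sum>i=1..L. \<omega> i * (magnetic_field (U_tilde i) $ 1 - magnetic_field (U_hat i) $ 1)) / \<Delta>x
       + (\<Sum>i=1..L. \<omega> i * (magnetic_field (U_bar i) $ 2 - magnetic_field (U_breve i) $ 2)) / \<Delta>y
       + (\<Sum>i=1..L. \<omega> i * (magnetic_field (U_bar2 i) $ 3 - magnetic_field (U_breve2 i) $ 3)) / \<Delta>z"
      unfolding face_sum sum_divide_distrib sum.distrib[symmetric]
      by (simp add: c_def h_def U_def V_def)
    then show ?thesis using assms(15) by simp
  qed
  have "(1 / (2 * sum c J)) *\<^sub>R
    (\<Sum>j\<in>J. c j *\<^sub>R (U j - \<theta> *\<^sub>R flux \<Gamma> (snd j) (U j) + V j + \<theta> *\<^sub>R flux \<Gamma> (snd j) (V j)))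
    \<in> admissible_states \<Gamma>"
  proof (rule face_average_admissible[OF assms(1,2) _ _ _ _ _ balance])
    show "finite J" "J \<noteq> {}" using assms(6) by (auto simp: J_def)
    show "c j > 0" if "j \<in> J" for j
      using that assms(3-5,7) by (auto simp: J_def c_def h_def)
    show "U j \<in> admissible_states \<Gamma>" if "j \<in> J" for j
      using that assms(9,11,13) by (auto simp: J_def U_def)
    show "V j \<in> admissible_states \<Gamma>" if "j \<in> J" for j
      using that assms(10,12,14) by (auto simp: J_def V_def)
    show "\<bar>\<theta>\<bar> \<le> 1" using assms(16) by (simp add: \<theta>_def field_simps)
  qed
  then show ?thesis
    unfolding total unfolding face_sum
    by (simp add: c_def h_def U_def V_def \<theta>_def scaleR_add_right)
qed

end
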